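(* For every $\varepsilon,\eta>0$, there exist constants $\delta=\delta(\varepsilon,\eta)>0$ and $C=C(\varepsilon)>0$ (with $C$ depending only on $\varepsilon$, not on $\eta$) with the following property: for all $n,r\in\mathbb{N}$ with $\varepsilon n\le r\le(1/2-\varepsilon)n$, we have \[ e(\mathcal{A})\ge \ell(\mathcal{A})^{1+\delta}-C\,\ell(\mathcal{A}) \] for any family $\mathcal{A}$ of $r$-element subsets of $[n]=\{1,\dots,n\}$ with $|\mathcal{A}|=\binom{n-1}{r-1}$ and $\ell(\mathcal{A})\le\binom{n-1}{r-1}^{1-\eta}$.
   Context: For a family $\mathcal{A}$ of $r$-element subsets of $[n]$, $e(\mathcal{A})$ denotes the number of (unordered) pairs of disjoint sets in $\mathcal{A}$. A family is intersecting if any two of its members have nonempty intersection. $\ell(\mathcal{A})=|\mathcal{A}|-|\mathcal{A}^*|$, where $\mathcal{A}^*$ is an intersecting subfamily of $\mathcal{A}$ of maximum cardinality. *)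

theory Defs
  imports Complex_Main
begin

definition uniform_family :: "nat \<Rightarrow> nat \<Rightarrow> nat set set \<Rightarrow> bool" where
  "uniform_family n r \<A> \<longleftrightarrow> \<A> \<subseteq> {X. X \<subseteq> {1..n} \<and> card X = r}"

text \<open>The two members need not be distinct, so an intersecting family never contains the empty
  set.  For families of nonempty sets this agrees with quantifying over distinct members only.\<close>

definition intersecting :: "'a set set \<Rightarrow> bool" where
  "intersecting \<F> \<longleftrightarrow> (\<forall>X\<in>\<F>. \<forall>Y\<in>\<F>. X \<inter> Y \<noteq> {})"

text \<open>Each unordered pair is counted once, as the two-element set of its members.\<close>

definition disjoint_pairs :: "'a set set \<Rightarrow> nat" where
  "disjoint_pairs \<A> = card {{X, Y} | X Y. X \<in> \<A> \<and> Y \<in> \<A> \<and> X \<noteq> Y \<and> X \<inter> Y = {}}"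

text \<open>Meaningful for finite families only (the maximum is taken over a finite set that contains
  the cardinality of the empty subfamily); the subtraction on \<^typ>\<open>nat\<close> then never truncates.\<close>

definition intersecting_distance :: "'a set set \<Rightarrow> nat" where
  "intersecting_distance \<A> = card \<A> - Max (card ` {\<B>. \<B> \<subseteq> \<A> \<and> intersecting \<B>})"

end

theory Submission
  imports Defs "HOL-Combinatorics.Permutations" "HOL-Real_Asymp.Real_Asymp"
begin

text \<open>
  A robust version of Katona's cycle argument. Order \<open>[n]\<close> cyclically at random. Since the family
  has size \<open>binom(n-1, r-1)\<close>, the expected number of its members that are arcs of the order is exactly
  \<open>r\<close>, while an order without disjoint arcs in the family has at most \<open>r\<close> of them; hence, up to a
  factor \<open>n\<close>, an order is either bad (it has two disjoint arcs in the family) or has exactly \<open>r\<close>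
  arcs in the family, and then these are the arcs through one point, the centre. Swapping adjacent
  elements away from the centre does not move it, unless the new order is exceptional. Following words
  in adjacent transpositions, one sees that for some \<open>x\<close> almost all orders have centre \<open>x\<close>, so that
  few members of the family avoid \<open>x\<close>. Counting bad orders by disjoint pairs gives
  \<open>l(A) * binom(n-r, r) \<le> 8 * n^7 * e(A)\<close>, and \<open>binom(n-r, r)\<close> is exponentially large in \<open>n\<close>.
\<close>

section \<open>Permutations with prescribed images\<close>

lemma ex_permutes_mapping_pair:
  assumes V: "finite V" and P: "P \<subseteq> V" "Q \<subseteq> V" "P \<inter> Q = {}"
    and X: "X \<subseteq> V" "Y \<subseteq> V" "X \<inter> Y = {}" and c: "card P = card X" "card Q = card Y"
  obtains \<pi> where "\<pi> permutes V" "\<pi> ` P = X" "\<pi> ` Q = Y"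
proof -
  have fin: "finite P" "finite Q" "finite X" "finite Y"
    using V P X finite_subset by blast+
  obtain f where f: "bij_betw f P X" using finite_same_card_bij fin c by blast
  obtain g where g: "bij_betw g Q Y" using finite_same_card_bij fin c by blast
  have "card (V - (P \<union> Q)) = card (V - (X \<union> Y))"
    using V P X c fin by (simp add: card_Diff_subset card_Un_disjoint)
  then obtain h where h: "bij_betw h (V - (P \<union> Q)) (V - (X \<union> Y))"
    using finite_same_card_bij V by blast
  \<comment> \<open>Glue the bijections on \<open>P\<close>, on \<open>Q\<close> and on the rest;
    \<open>permutes\<close> demands the identity outside \<open>V\<close>.\<close>
  define k where "k = (\<lambda>v. if v \<in> P then f v else if v \<in> Q then g v else if v \<in> V then h v else v)"
  have kP: "bij_betw k P X" using f by (rule iffD1[OF bij_betw_cong, rotated]) (simp add: k_def)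
  have kQ: "bij_betw k Q Y" using g P by (intro iffD1[OF bij_betw_cong g]) (auto simp add: k_def)
  have kR: "bij_betw k (V - (P \<union> Q)) (V - (X \<union> Y))"
    by (intro iffD1[OF bij_betw_cong h]) (auto simp add: k_def)
  have "bij_betw k (P \<union> Q \<union> (V - (P \<union> Q))) (X \<union> Y \<union> (V - (X \<union> Y)))"
    using kP kQ kR X(3) by (intro bij_betw_combine) auto
  moreover have "P \<union> Q \<union> (V - (P \<union> Q)) = V" "X \<union> Y \<union> (V - (X \<union> Y)) = V" using P X by auto
  ultimately have "k permutes V" using P by (intro bij_imp_permutes) (auto simp: k_def)
  moreover have "k ` P = X" "k ` Q = Y" using kP kQ by (auto simp: bij_betw_def)
  ultimately show thesis using that by blast
qed

text \<open>All ordered pairs of disjoint targets of the given sizes are hit equally often: left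
  composition with a permutation carrying one pair to another injects fibre into fibre. The fibres
  partition the permutations of \<open>V\<close>, and the product of binomials counts the
  targets.\<close>

lemma card_permutes_mapping_pair:
  assumes V: "finite V" and P: "P \<subseteq> V" "Q \<subseteq> V" "P \<inter> Q = {}"
    and X: "X \<subseteq> V" "Y \<subseteq> V" "X \<inter> Y = {}" and c: "card P = card X" "card Q = card Y"
  shows "card {\<sigma>. \<sigma> permutes V \<and> \<sigma> ` P = X \<and> \<sigma> ` Q = Y}
    * ((card V choose card X) * ((card V - card X) choose card Y)) = fact (card V)"
proof -
  define F where "F = (\<lambda>(X, Y). {\<sigma>. \<sigma> permutes V \<and> \<sigma> ` P = X \<and> \<sigma> ` Q = Y})"
  define K where "K = Sigma {Z. Z \<subseteq> V \<and> card Z = card X} (\<lambda>Z. {W. W \<subseteq> V - Z \<and> card W = card Y})"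
  have finF: "finite (F z)" for z
    by (rule finite_subset[OF _ finite_permutations[OF V]]) (auto simp: F_def split: prod.splits)
  have finK: "finite K" unfolding K_def using V by (intro finite_SigmaI) auto
  have le: "card (F z) \<le> card (F w)" if zw: "z \<in> K" "w \<in> K" for z w
  proof -
    obtain \<pi> where pi: "\<pi> permutes V" "\<pi> ` fst z = fst w" "\<pi> ` snd z = snd w"
    proof (rule ex_permutes_mapping_pair[OF V, of "fst z" "snd z" "fst w" "snd w"])
    qed (use zw in \<open>auto simp: K_def\<close>)
    have "inj_on (\<lambda>\<sigma>. \<pi> \<circ> \<sigma>) (F z)"
      using permutes_inj[OF pi(1)] by (intro inj_onI) (simp add: fun.inj_map inj_eq comp_def fun_eq_iff)
    moreover have "(\<lambda>\<sigma>. \<pi> \<circ> \<sigma>) ` F z \<subseteq> F w"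
      using pi by (auto simp: F_def permutes_compose image_comp[symmetric] split: prod.splits)
    ultimately show ?thesis using card_inj_on_le finF by blast
  qed
  have XY: "(X, Y) \<in> K" using X by (auto simp: K_def)
  have "{\<sigma>. \<sigma> permutes V} = (\<Union>z\<in>K. F z)"
  proof (intro equalityI subsetI)
    fix \<sigma> assume "\<sigma> \<in> {\<sigma>. \<sigma> permutes V}"
    then have s: "\<sigma> permutes V" by simp
    have "\<sigma> ` P \<subseteq> V" "\<sigma> ` Q \<subseteq> V" using P permutes_image[OF s] by blast+
    moreover have "\<sigma> ` P \<inter> \<sigma> ` Q = {}"
      using P(3) permutes_inj[OF s] by (metis image_Int image_empty)
    moreover have "card (\<sigma> ` P) = card X" "card (\<sigma> ` Q) = card Y"
      using c permutes_inj_on[OF s] by (simp_all add: card_image)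
    ultimately have "(\<sigma> ` P, \<sigma> ` Q) \<in> K" by (auto simp: K_def)
    moreover have "\<sigma> \<in> F (\<sigma> ` P, \<sigma> ` Q)" using s by (simp add: F_def)
    ultimately show "\<sigma> \<in> (\<Union>z\<in>K. F z)" by blast
  qed (auto simp: F_def split: prod.splits)
  then have "fact (card V) = card (\<Union>z\<in>K. F z)"
    using card_permutations[OF refl V] by simp
  also have "\<dots> = (\<Sum>z\<in>K. card (F z))"
    using finK finF by (intro card_UN_disjoint) (auto simp: F_def)
  also have "\<dots> = (\<Sum>z\<in>K. card (F (X, Y)))"
    using le XY by (intro sum.cong) (auto intro!: antisym)
  also have "\<dots> = card K * card (F (X, Y))" by simp
  also have "card K = (\<Sum>Z | Z \<subseteq> V \<and> card Z = card X. card {W. W \<subseteq> V - Z \<and> card W = card Y})"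
    unfolding K_def using V by (intro card_SigmaI) auto
  also have "\<dots> = (\<Sum>Z | Z \<subseteq> V \<and> card Z = card X. (card V - card X) choose card Y)"
    using V by (intro sum.cong) (auto simp: n_subsets card_Diff_subset finite_subset)
  also have "\<dots> = (card V choose card X) * ((card V - card X) choose card Y)"
    using V by (simp add: n_subsets)
  finally show ?thesis by (simp add: F_def mult.commute)
qed

lemma card_permutes_mapping:
  assumes "finite V" "P \<subseteq> V" "X \<subseteq> V" "card P = card X"
  shows "card {\<sigma>. \<sigma> permutes V \<and> \<sigma> ` P = X} * (card V choose card X) = fact (card V)"
  using card_permutes_mapping_pair[of V P "{}" X "{}"] assms by simp

section \<open>Arcs of cyclic orders\<close>

locale cyclic_arcs =
  fixes n r :: nat and \<A> :: "nat set set"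
  assumes r_pos: "1 \<le> r" and n_ge: "2 * r + 2 \<le> n"
    and uniform: "\<A> \<subseteq> {X. X \<subseteq> {1..n} \<and> card X = r}"
begin

text \<open>Positions are indexed by all integers and reduced modulo \<open>n\<close>, so that arcs
  can be shifted without treating wrap-around. Index \<open>0\<close> is position \<open>1\<close>,
  which is why the centre later appears as \<open>\<sigma> 1\<close>.\<close>

definition pos :: "int \<Rightarrow> nat" where
  "pos i = nat (i mod int n) + 1"

definition arc :: "(nat \<Rightarrow> nat) \<Rightarrow> int \<Rightarrow> nat set" where
  "arc \<sigma> i = \<sigma> ` pos ` {i..<i + int r}"

text \<open>The inequalities say that the two arcs do not overlap on the cycle: the second starts
  after the first has ended and ends before the first starts again.\<close>

definition bad :: "(nat \<Rightarrow> nat) \<Rightarrow> bool" where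
  "bad \<sigma> \<longleftrightarrow> (\<exists>i j. i + int r \<le> j \<and> j + int r \<le> i + int n \<and> arc \<sigma> i \<in> \<A> \<and> arc \<sigma> j \<in> \<A>)"

text \<open>For a cyclic order that is not bad this says that exactly \<open>r\<close> arcs lie in the family, in a form
  that is evidently invariant under rotation.\<close>

definition good :: "(nat \<Rightarrow> nat) \<Rightarrow> bool" where
  "good \<sigma> \<longleftrightarrow> \<not> bad \<sigma> \<and> (\<exists>i. arc \<sigma> i \<in> \<A>) \<and>
    (\<forall>i k. arc \<sigma> i \<in> \<A> \<and> 1 \<le> k \<and> k < int r \<longrightarrow> arc \<sigma> (i + k) \<in> \<A> \<or> arc \<sigma> (i + k - int r) \<in> \<A>)"

section \<open>Arithmetic of positions modulo \<open>n\<close>\<close>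

lemma n_pos: "0 < int n"
  using n_ge by simp

lemma pos_in: "pos i \<in> {1..n}"
proof -
  have "0 \<le> i mod int n" "i mod int n < int n" using n_pos by simp_all
  then show ?thesis by (auto simp: pos_def)
qed

lemma pos_eq_iff: "pos i = pos j \<longleftrightarrow> i mod int n = j mod int n"
  using n_pos by (auto simp: pos_def nat_eq_iff)

lemma pos_small: "0 \<le> i \<Longrightarrow> i < int n \<Longrightarrow> pos i = nat i + 1"
  by (simp add: pos_def)

lemma pos_mod_add [simp]: "pos (i mod int n + k) = pos (i + k)"
  by (simp add: pos_eq_iff mod_add_left_eq)

lemma pos_add_mod [simp]: "pos (k + i mod int n) = pos (k + i)"
  by (simp add: pos_eq_iff mod_add_right_eq)

lemma inj_on_pos: "inj_on pos {a..<a + int n}"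
proof (rule inj_onI)
  fix x y assume xy: "x \<in> {a..<a + int n}" "y \<in> {a..<a + int n}" and "pos x = pos y"
  then have "(x - a) mod int n = (y - a) mod int n"
    by (intro mod_diff_cong) (simp_all add: pos_eq_iff)
  moreover have "(x - a) mod int n = x - a" "(y - a) mod int n = y - a"
    using xy by (auto intro: mod_pos_pos_trivial)
  ultimately show "x = y" by linarith
qed

lemma arc_shift: "arc \<sigma> (i + k) = (\<lambda>l. \<sigma> (pos (l + k))) ` {i..<i + int r}"
proof -
  have "{i + k..<i + k + int r} = (\<lambda>l. l + k) ` {i..<i + int r}"
    by (simp add: algebra_simps)
  then show ?thesis by (simp only: arc_def image_image)
qed

lemma arc_mod [simp]: "arc \<sigma> (i mod int n) = arc \<sigma> i"
proof -
  have "arc \<sigma> (0 + i mod int n) = arc \<sigma> (0 + i)"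
    unfolding arc_shift by simp
  then show ?thesis by simp
qed

lemma arc_cong: "i mod int n = j mod int n \<Longrightarrow> arc \<sigma> i = arc \<sigma> j"
  by (metis arc_mod)

lemma pos_arc_disjoint:
  assumes "i + int r \<le> j" "j + int r \<le> i + int n"
  shows "pos ` {i..<i + int r} \<inter> pos ` {j..<j + int r} = {}"
proof -
  have "pos ` ({i..<i + int r} \<inter> {j..<j + int r}) = pos ` {i..<i + int r} \<inter> pos ` {j..<j + int r}"
    using assms by (intro inj_on_image_Int[OF inj_on_pos[of i]]) auto
  then show ?thesis using assms by auto
qed

lemma card_pos_arc: "card (pos ` {i..<i + int r}) = r"
proof -
  have "inj_on pos {i..<i + int r}"
    by (rule inj_on_subset[OF inj_on_pos[of i]]) (use n_ge in auto)
  then show ?thesis by (simp add: card_image)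
qed

text \<open>Within one window of \<open>n\<close> consecutive integers \<open>pos\<close> is
  injective, so membership modulo \<open>n\<close> becomes a comparison of integers.\<close>

lemma pos_mem_iff:
  assumes "a \<in> {u..<u + int n}" "u \<le> i" "i + int r \<le> u + int n"
  shows "pos a \<in> pos ` {i..<i + int r} \<longleftrightarrow> a \<in> {i..<i + int r}"
  using assms by (intro inj_on_image_mem_iff[OF inj_on_pos[of u]]) auto

lemma not_bad_conflict:
  assumes "\<not> bad \<sigma>" "arc \<sigma> i \<in> \<A>" "i + int r \<le> j" "j + int r \<le> i + int n"
  shows "arc \<sigma> j \<notin> \<A>"
  using assms by (auto simp: bad_def)

text \<open>Katona's bound: around a member \<open>arc i\<close>, the remaining members start in
  \<open>{i-r+1..i+r-1}\<close>, and starts congruent modulo \<open>r\<close> there give disjoint arcs.\<close>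

lemma katona_residues:
  assumes nb: "\<not> bad \<sigma>" and i: "arc \<sigma> i \<in> \<A>"
  defines "J \<equiv> {j. i - int r < j \<and> j < i + int r \<and> arc \<sigma> j \<in> \<A>}"
  shows "inj_on (\<lambda>j. (j - i) mod int r) J"
    and "card {k \<in> {0..<int n}. arc \<sigma> k \<in> \<A>} \<le> card ((\<lambda>j. (j - i) mod int r) ` J)"
proof -
  show inj: "inj_on (\<lambda>j. (j - i) mod int r) J"
  proof -
    have "\<not> j < k" if "j \<in> J" "k \<in> J" "(j - i) mod int r = (k - i) mod int r" for j k
    proof
      assume jk: "j < k"
      have "int r dvd (k - i) - (j - i)" using that(3) by (metis mod_eq_dvd_iff)
      then have "int r dvd k - j" by simp
      then have "j + int r \<le> k" using jk zdvd_imp_le[of "int r" "k - j"] by simp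
      \<comment> \<open>Here \<open>k - j\<close> is a positive multiple of \<open>r\<close> below
        \<open>2 * r\<close>, hence equal to \<open>r\<close>, which leaves room on the other side
        of the cycle as well.\<close>
      moreover have "k + int r \<le> j + int n"
      proof -
        obtain q where q: "k - j = int r * q" using \<open>int r dvd k - j\<close> by blast
        have "k - j < 2 * int r" using that by (auto simp: J_def)
        then have "q < 2" using q r_pos by (metis mult.commute mult_less_cancel_left_pos of_nat_0_less_iff less_le_trans zero_less_one)
        then have "k - j \<le> int r" using q r_pos mult_left_mono[of q 1 "int r"] by simp
        then show ?thesis using n_ge by simp
      qed
      ultimately show False using not_bad_conflict[OF nb, of j k] that by (auto simp: J_def)
    qed
    then show ?thesis by (intro inj_onI) (metis linorder_neqE)
  qed
  have finJ: "finite J"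
    by (rule finite_subset[of _ "{i - int r..i + int r}"]) (auto simp: J_def)
  have "{k \<in> {0..<int n}. arc \<sigma> k \<in> \<A>} \<subseteq> (\<lambda>j. j mod int n) ` J"
  proof
    fix k assume k: "k \<in> {k \<in> {0..<int n}. arc \<sigma> k \<in> \<A>}"
    \<comment> \<open>The representative of \<open>k\<close> in the window of length
      \<open>n\<close> that starts at \<open>i - r + 1\<close>. Starts from \<open>i + r\<close> on
      are impossible there, since their arcs miss \<open>arc \<sigma> i\<close>.\<close>
    define j where "j = (k - (i - int r + 1)) mod int n + (i - int r + 1)"
    have jm: "j mod int n = k" using k by (simp add: j_def mod_add_left_eq)
    have jA: "arc \<sigma> j \<in> \<A>" using k jm by (metis (mono_tags, lifting) arc_mod mem_Collect_eq)
    have "i - int r + 1 \<le> j" "j < i - int r + 1 + int n" using n_pos by (simp_all add: j_def)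
    moreover have "j < i + int r"
    proof (rule ccontr)
      assume "\<not> j < i + int r"
      then show False using not_bad_conflict[OF nb i, of j] jA \<open>j < i - int r + 1 + int n\<close> by simp
    qed
    ultimately have "j \<in> J" using jA by (simp add: J_def)
    with jm show "k \<in> (\<lambda>j. j mod int n) ` J" by blast
  qed
  then have "card {k \<in> {0..<int n}. arc \<sigma> k \<in> \<A>} \<le> card J"
    by (rule surj_card_le[OF finJ])
  then show "card {k \<in> {0..<int n}. arc \<sigma> k \<in> \<A>} \<le> card ((\<lambda>j. (j - i) mod int r) ` J)"
    using card_image[OF inj] by simp
qed

lemma katona_bound:
  assumes "\<not> bad \<sigma>"
  shows "card {k \<in> {0..<int n}. arc \<sigma> k \<in> \<A>} \<le> r"
proof (cases "\<exists>i. arc \<sigma> i \<in> \<A>")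
  case True
  then obtain i where i: "arc \<sigma> i \<in> \<A>" by blast
  have "(\<lambda>j. (j - i) mod int r) ` {j. i - int r < j \<and> j < i + int r \<and> arc \<sigma> j \<in> \<A>} \<subseteq> {0..<int r}"
    using r_pos by auto
  from card_mono[OF _ this] katona_residues(2)[OF assms i] show ?thesis by simp
qed simp

section \<open>Structure of good orders\<close>

lemma good_if_full:
  assumes nb: "\<not> bad \<sigma>" and full: "r \<le> card {k \<in> {0..<int n}. arc \<sigma> k \<in> \<A>}"
  shows "good \<sigma>"
  unfolding good_def
proof (intro conjI allI impI)
  show "\<exists>i. arc \<sigma> i \<in> \<A>"
    using full r_pos by (metis (no_types, lifting) card.empty empty_Collect_eq not_one_le_zero le_trans)
next
  fix i k assume *: "arc \<sigma> i \<in> \<A> \<and> 1 \<le> k \<and> k < int r"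
  let ?J = "{j. i - int r < j \<and> j < i + int r \<and> arc \<sigma> j \<in> \<A>}"
  have sub: "(\<lambda>j. (j - i) mod int r) ` ?J \<subseteq> {0..<int r}" using r_pos by auto
  have "(\<lambda>j. (j - i) mod int r) ` ?J = {0..<int r}"
    using katona_residues(2)[OF nb, of i] * full by (intro card_subset_eq sub) (auto intro!: antisym card_mono[OF _ sub, simplified])
  then have "k \<in> (\<lambda>j. (j - i) mod int r) ` ?J" using * by simp
  then obtain j where j: "j \<in> ?J" "k = (j - i) mod int r" by blast
  show "arc \<sigma> (i + k) \<in> \<A> \<or> arc \<sigma> (i + k - int r) \<in> \<A>"
  proof (cases "i \<le> j")
    case True
    then have "k = j - i" using j by simp
    then show ?thesis using j by simp
  next
    case False
    have "k = (j - i + int r) mod int r" using j by simp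
    also have "\<dots> = j - i + int r" using False j by (intro mod_pos_pos_trivial) auto
    finally show ?thesis using j by (simp add: algebra_simps)
  qed
qed (fact nb)

text \<open>If \<open>p + m\<close> is not the start of a member, goodness makes
  \<open>p + m - r\<close> one, and its arc is disjoint from the arc at \<open>p + m + 1\<close>. So
  the absence after \<open>p\<close> propagates up to \<open>p + r - 1\<close>, and goodness then
  supplies every start back to \<open>p - r + 1\<close>.\<close>

lemma good_last:
  assumes g: "good \<sigma>" and p: "arc \<sigma> p \<in> \<A>" "arc \<sigma> (p + 1) \<notin> \<A>" and k: "k < r"
  shows "arc \<sigma> (p - int k) \<in> \<A>"
proof -
  have nb: "\<not> bad \<sigma>" using g by (simp add: good_def)
  have ex: "arc \<sigma> (p + k) \<in> \<A> \<or> arc \<sigma> (p + k - int r) \<in> \<A>" if "1 \<le> k" "k < int r" for k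
    using g p that unfolding good_def by blast
  have no: "Suc m < r \<Longrightarrow> arc \<sigma> (p + int (Suc m)) \<notin> \<A>" for m
  proof (induction m)
    case 0 then show ?case using p by simp
  next
    case (Suc m)
    then have "arc \<sigma> (p + int (Suc m) - int r) \<in> \<A>" using ex[of "int (Suc m)"] by simp
    then show ?case by (rule not_bad_conflict[OF nb]) (use n_ge in simp_all)
  qed
  show ?thesis
  proof (cases "k = 0")
    case False
    then have "arc \<sigma> (p + int (r - k)) \<notin> \<A>" using no[of "r - k - 1"] k by simp
    then have "arc \<sigma> (p + int (r - k) - int r) \<in> \<A>" using ex[of "int (r - k)"] False k by simp
    moreover have "p + int (r - k) - int r = p - int k" using k by simp
    ultimately show ?thesis by simp
  qed (use p in simp)
qed

text \<open>Mirror image of \<open>good_last\<close>: the absence before \<open>p\<close> propagates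
  backwards.\<close>

lemma good_first:
  assumes g: "good \<sigma>" and p: "arc \<sigma> p \<in> \<A>" "arc \<sigma> (p - 1) \<notin> \<A>" and k: "k < r"
  shows "arc \<sigma> (p + int k) \<in> \<A>"
proof -
  have nb: "\<not> bad \<sigma>" using g by (simp add: good_def)
  have ex: "arc \<sigma> (p + k) \<in> \<A> \<or> arc \<sigma> (p + k - int r) \<in> \<A>" if "1 \<le> k" "k < int r" for k
    using g p that unfolding good_def by blast
  have no: "Suc m < r \<Longrightarrow> arc \<sigma> (p - int (Suc m)) \<notin> \<A>" for m
  proof (induction m)
    case 0 then show ?case using p by simp
  next
    case (Suc m)
    then have *: "arc \<sigma> (p + (int r - int (Suc m))) \<in> \<A>" using ex[of "int r - int (Suc m)"]
      by (simp add: algebra_simps)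
    show ?case
    proof
      assume "arc \<sigma> (p - int (Suc (Suc m))) \<in> \<A>"
      then have "arc \<sigma> (p + (int r - int (Suc m))) \<notin> \<A>"
        by (rule not_bad_conflict[OF nb]) (use n_ge in simp_all)
      with * show False by simp
    qed
  qed
  show ?thesis
  proof (cases "k = 0")
    case False
    then have "arc \<sigma> (p - int (r - k)) \<notin> \<A>" using no[of "r - k - 1"] k by simp
    moreover have "p + int k - int r = p - int (r - k)" using k by simp
    moreover have "arc \<sigma> (p + int k) \<in> \<A> \<or> arc \<sigma> (p + int k - int r) \<in> \<A>"
      using False k by (intro ex) auto
    ultimately show ?thesis by metis
  qed (use p in simp)
qed

text \<open>Moving forward from a member one start at a time must leave the family, because the arc
  \<open>r\<close> steps on is disjoint from the first one.\<close>

lemma ex_last: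
  assumes "good \<sigma>"
  obtains p where "p \<in> {0..<int n}" "arc \<sigma> p \<in> \<A>" "arc \<sigma> (p + 1) \<notin> \<A>"
proof -
  obtain i where i: "arc \<sigma> i \<in> \<A>" and nb: "\<not> bad \<sigma>" using assms by (auto simp: good_def)
  have nir: "arc \<sigma> (i + int r) \<notin> \<A>" by (rule not_bad_conflict[OF nb i]) (use n_ge in simp_all)
  have "\<exists>m. arc \<sigma> (i + int m) \<in> \<A> \<and> arc \<sigma> (i + int m + 1) \<notin> \<A>"
  proof (rule ccontr)
    assume *: "\<not> ?thesis"
    have "arc \<sigma> (i + int m) \<in> \<A>" for m
      by (induction m) (use i * in \<open>auto simp: algebra_simps\<close>)
    with nir show False by blast
  qed
  then obtain m where m: "arc \<sigma> (i + int m) \<in> \<A>" "arc \<sigma> (i + int m + 1) \<notin> \<A>" by blast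
  have "arc \<sigma> ((i + int m) mod int n + 1) = arc \<sigma> (i + int m + 1)"
    by (rule arc_cong) (simp add: mod_add_left_eq)
  with m show thesis using n_pos by (intro that[of "(i + int m) mod int n"]) simp_all
qed

section \<open>Rotating a cyclic order\<close>

definition rot :: "int \<Rightarrow> nat \<Rightarrow> nat" where
  "rot k v = (if v \<in> {1..n} then pos (int v - 1 + k) else v)"

lemma rot_pos: "rot k (pos i) = pos (i + k)"
proof -
  have "int (pos i) - 1 = i mod int n" using n_pos by (simp add: pos_def)
  then show ?thesis using pos_in by (simp add: rot_def)
qed

lemma rot_permutes: "rot k permutes {1..n}"
proof (rule bij_imp_permutes)
  have "rot k ` {1..n} \<subseteq> {1..n}" using pos_in by (auto simp: rot_def)
  moreover have "inj_on (rot k) {1..n}"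
  proof (rule inj_onI)
    fix v w assume vw: "v \<in> {1..n}" "w \<in> {1..n}" "rot k v = rot k w"
    then have "(int v - 1 + k) mod int n = (int w - 1 + k) mod int n"
      by (simp add: rot_def pos_eq_iff)
    then have "(int v - 1 + k - k) mod int n = (int w - 1 + k - k) mod int n"
      by (rule mod_diff_cong) simp
    then show "v = w" using vw by simp
  qed
  ultimately show "bij_betw (rot k) {1..n} {1..n}"
    by (simp add: bij_betw_def endo_inj_surj)
qed (auto simp: rot_def)

lemma arc_rot: "arc (\<sigma> \<circ> rot k) i = arc \<sigma> (i + k)"
  unfolding arc_shift by (simp add: arc_def image_image rot_pos)

lemma good_rot:
  assumes "good \<sigma>"
  shows "good (\<sigma> \<circ> rot k)"
proof -
  have "\<not> bad (\<sigma> \<circ> rot k)"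
  proof
    assume "bad (\<sigma> \<circ> rot k)"
    then obtain i j where "i + int r \<le> j" "j + int r \<le> i + int n" "arc \<sigma> (i + k) \<in> \<A>" "arc \<sigma> (j + k) \<in> \<A>"
      by (auto simp: bad_def arc_rot)
    then have "bad \<sigma>" unfolding bad_def by (intro exI[of _ "i + k"] exI[of _ "j + k"]) simp
    with assms show False by (simp add: good_def)
  qed
  moreover have "\<exists>i. arc (\<sigma> \<circ> rot k) i \<in> \<A>"
  proof -
    obtain i where "arc \<sigma> i \<in> \<A>" using assms by (auto simp: good_def)
    then show ?thesis by (intro exI[of _ "i - k"]) (simp add: arc_rot)
  qed
  moreover have "arc (\<sigma> \<circ> rot k) (i + l) \<in> \<A> \<or> arc (\<sigma> \<circ> rot k) (i + l - int r) \<in> \<A>"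
    if "arc (\<sigma> \<circ> rot k) i \<in> \<A>" "1 \<le> l" "l < int r" for i l
  proof -
    have "arc \<sigma> (i + k + l) \<in> \<A> \<or> arc \<sigma> (i + k + l - int r) \<in> \<A>"
      using assms that unfolding good_def arc_rot by blast
    moreover have "i + k + l = i + l + k" "i + k + l - int r = i + l - int r + k" by simp_all
    ultimately show ?thesis unfolding arc_rot by metis
  qed
  ultimately show ?thesis unfolding good_def by blast
qed

text \<open>In a good order the conditions on \<open>arc \<sigma> 0\<close> and \<open>arc \<sigma> 1\<close> force the arcs in the family to be
  exactly those through position \<open>0\<close>.\<close>

definition centred :: "nat \<Rightarrow> (nat \<Rightarrow> nat) set" where
  "centred x = {\<sigma>. \<sigma> permutes {1..n} \<and> good \<sigma> \<and> arc \<sigma> 0 \<in> \<A> \<and> arc \<sigma> 1 \<notin> \<A> \<and> \<sigma> 1 = x}"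

section \<open>Stability of the centre under adjacent swaps\<close>

lemma arc_comp_transpose:
  assumes "pos a \<in> pos ` {i..<i + int r} \<longleftrightarrow> pos b \<in> pos ` {i..<i + int r}"
  shows "arc (\<sigma> \<circ> transpose (pos a) (pos b)) i = arc \<sigma> i"
proof -
  have "transpose (pos a) (pos b) ` pos ` {i..<i + int r} = pos ` {i..<i + int r}"
    using assms by (simp only: transpose_image_eq)
  then show ?thesis unfolding arc_def image_comp[symmetric] by simp
qed

text \<open>The swap avoids index \<open>0\<close>, so it can change \<open>arc \<sigma> 0\<close>
  or \<open>arc \<sigma> 1\<close> only at \<open>j = r - 1\<close> or \<open>j = r\<close>. Then
  the opposite end of the run, at start \<open>1 - r\<close>, is unaffected, and goodness of the new
  order rebuilds the run from there.\<close>

lemma centred_step: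
  assumes s: "\<sigma> \<in> centred x" and j: "1 \<le> j" "j + 1 < int n"
    and g: "good (\<sigma> \<circ> transpose (pos j) (pos (j + 1)))"
  shows "\<sigma> \<circ> transpose (pos j) (pos (j + 1)) \<in> centred x"
proof -
  let ?t = "transpose (pos j) (pos (j + 1))"
  have gs: "good \<sigma>" and a0: "arc \<sigma> 0 \<in> \<A>" "arc \<sigma> 1 \<notin> \<A>" using s by (simp_all add: centred_def)
  have nb: "\<not> bad \<sigma>" "\<not> bad (\<sigma> \<circ> ?t)" using gs g by (simp_all add: good_def)
  have "arc (\<sigma> \<circ> ?t) 0 \<in> \<A> \<and> arc (\<sigma> \<circ> ?t) 1 \<notin> \<A>"
  proof (cases "j = int r - 1 \<or> j = int r")
    case False
    have "arc (\<sigma> \<circ> ?t) 0 = arc \<sigma> 0" "arc (\<sigma> \<circ> ?t) 1 = arc \<sigma> 1"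
      using j n_ge False by (intro arc_comp_transpose; subst (1 2) pos_mem_iff[where u = 0]; auto)+
    then show ?thesis using a0 by simp
  next
    case True
    \<comment> \<open>The window starting at \<open>- r\<close> must also contain
      \<open>j + 1 \<le> r + 1\<close>; this takes \<open>2 * r + 2\<close> indices distinct modulo
      \<open>n\<close>, as \<open>n_ge\<close> provides.\<close>
    have e: "arc (\<sigma> \<circ> ?t) (1 - int r) = arc \<sigma> (1 - int r)" "arc (\<sigma> \<circ> ?t) (1 - int r - 1) = arc \<sigma> (1 - int r - 1)"
      using j n_ge True by (intro arc_comp_transpose; subst (1 2) pos_mem_iff[where u = "- int r"]; auto)+
    have f: "arc \<sigma> (1 - int r) \<in> \<A>" using good_last[OF gs, of 0 "r - 1"] a0 r_pos by simp
    have "arc \<sigma> (1 - int r - 1) \<notin> \<A>"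
    proof
      assume "arc \<sigma> (1 - int r - 1) \<in> \<A>"
      then have "arc \<sigma> 0 \<notin> \<A>" by (rule not_bad_conflict[OF nb(1)]) (use n_ge in simp_all)
      with a0 show False by simp
    qed
    then have "arc (\<sigma> \<circ> ?t) (1 - int r + int (r - 1)) \<in> \<A>"
      using e f r_pos by (intro good_first[OF g]) auto
    then have "arc (\<sigma> \<circ> ?t) 0 \<in> \<A>" using r_pos by simp
    moreover have "arc (\<sigma> \<circ> ?t) 1 \<notin> \<A>"
      by (rule not_bad_conflict[OF nb(2), of "1 - int r"]) (use e f n_ge in simp_all)
    ultimately show ?thesis by simp
  qed
  moreover have "?t permutes {1..n}" using pos_in by (intro permutes_swap_id) auto
  then have "\<sigma> \<circ> ?t permutes {1..n}" using s by (auto simp: centred_def intro: permutes_compose)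
  moreover have "pos j \<noteq> 1" "pos (j + 1) \<noteq> 1" using j by (simp_all add: pos_small)
  then have "(\<sigma> \<circ> ?t) 1 = x" using s by (simp add: centred_def transpose_def)
  ultimately show ?thesis using g by (simp add: centred_def)
qed

end

section \<open>Counting cyclic orders\<close>

lemma comp_permutes_cancel:
  assumes "g permutes V" "\<sigma> \<circ> g = \<tau> \<circ> g"
  shows "\<sigma> = \<tau>"
proof
  fix x
  have "(\<sigma> \<circ> g) (inv g x) = (\<tau> \<circ> g) (inv g x)" by (simp only: assms(2))
  then show "\<sigma> x = \<tau> x" by (simp add: permutes_inverses(1)[OF assms(1)])
qed

text \<open>An escape under \<open>g \<circ> h\<close> happens either at \<open>g\<close> or, with
  \<open>\<sigma> \<circ> g\<close> still in \<open>E\<close>, at \<open>h\<close>. Right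
  composition with \<open>g\<close> is injective, so the second kind is bounded by the escapes under
  \<open>h\<close>.\<close>

lemma card_escape_comp:
  assumes E: "finite E" and g: "g permutes V"
  shows "card {\<sigma> \<in> E. \<sigma> \<circ> (g \<circ> h) \<notin> E} \<le> card {\<sigma> \<in> E. \<sigma> \<circ> g \<notin> E} + card {\<sigma> \<in> E. \<sigma> \<circ> h \<notin> E}"
proof -
  let ?G = "{\<sigma> \<in> E. \<sigma> \<circ> g \<in> E \<and> \<sigma> \<circ> g \<circ> h \<notin> E}"
  have "card ?G \<le> card {\<sigma> \<in> E. \<sigma> \<circ> h \<notin> E}"
    using E comp_permutes_cancel[OF g] by (intro card_inj_on_le[of "\<lambda>\<sigma>. \<sigma> \<circ> g"] inj_onI) auto
  moreover have "card {\<sigma> \<in> E. \<sigma> \<circ> (g \<circ> h) \<notin> E} \<le> card ({\<sigma> \<in> E. \<sigma> \<circ> g \<notin> E} \<union> ?G)"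
    using E by (intro card_mono) (auto simp: comp_assoc)
  ultimately show ?thesis using card_Un_le[of "{\<sigma> \<in> E. \<sigma> \<circ> g \<notin> E}" ?G] by linarith
qed

text \<open>Every permutation is a product of quadratically many adjacent transpositions, and leaving \<open>E\<close>
  along such a word must happen at one of its letters.\<close>

lemma card_escape_le:
  assumes E: "finite E"
    and adj: "\<And>v. a \<le> v \<Longrightarrow> v < n \<Longrightarrow> card {\<sigma> \<in> E. \<sigma> \<circ> transpose v (Suc v) \<notin> E} \<le> M"
    and g: "g permutes {a..n}"
  shows "card {\<sigma> \<in> E. \<sigma> \<circ> g \<notin> E} \<le> 2 * n * n * M"
proof -
  define esc where "esc g = card {\<sigma> \<in> E. \<sigma> \<circ> g \<notin> E}" for g
  have esc_comp: "esc (g \<circ> h) \<le> esc g + esc h" if "g permutes UNIV" for g h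
    unfolding esc_def using card_escape_comp[OF E that] .
  have esc_id: "esc id = 0" by (simp add: esc_def)
  have tr: "transpose v w permutes UNIV" for v w :: nat
    by (simp add: permutes_swap_id)
  have swap_up: "v + Suc d \<le> n \<Longrightarrow> esc (transpose v (v + Suc d)) \<le> 2 * Suc d * M" if "a \<le> v" for v d
  proof (induction d)
    case 0
    then show ?case using adj[OF that] by (simp add: esc_def)
  next
    case (Suc d)
    let ?b = "v + Suc d"
    \<comment> \<open>A longer transposition is a shorter one conjugated by an adjacent one, which
      costs two more letters.\<close>
    have "transpose v (Suc ?b) = transpose (Suc ?b) ?b \<circ> transpose ?b v \<circ> transpose (Suc ?b) ?b"
      by (subst transpose_comp_triple) (auto simp: transpose_commute)
    then have *: "transpose v (Suc ?b) = transpose ?b (Suc ?b) \<circ> (transpose v ?b \<circ> transpose ?b (Suc ?b))"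
      by (simp only: transpose_commute comp_assoc)
    have "esc (transpose v (Suc ?b)) \<le> esc (transpose ?b (Suc ?b)) + (esc (transpose v ?b) + esc (transpose ?b (Suc ?b)))"
      unfolding * using esc_comp[OF tr] by (meson add_left_mono le_trans)
    also have "\<dots> \<le> M + (2 * Suc d * M + M)"
      using Suc adj[of ?b] that by (intro add_mono) (auto simp: esc_def)
    finally show ?case by (simp add: algebra_simps)
  qed
  have swap_lt: "esc (transpose v w) \<le> 2 * n * M" if "a \<le> v" "v < w" "w \<le> n" for v w
  proof -
    have "esc (transpose v w) \<le> 2 * (w - v) * M"
      using swap_up[of v "w - v - 1"] that by (simp add: Suc_diff_Suc)
    also have "\<dots> \<le> 2 * n * M" using that by (intro mult_right_mono) auto
    finally show ?thesis .
  qed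
  have swap: "esc (transpose v w) \<le> 2 * n * M" if "v \<in> {a..n}" "w \<in> {a..n}" for v w
  proof (cases v w rule: linorder_cases)
    case equal then show ?thesis by (simp add: esc_def)
  next
    case less then show ?thesis using swap_lt that by simp
  next
    case greater then show ?thesis using swap_lt[of w v] that by (simp add: transpose_commute)
  qed
  have "m \<le> n \<Longrightarrow> g permutes {a..m} \<Longrightarrow> esc g \<le> 2 * n * m * M" for m
  proof (induction m arbitrary: g)
    case 0
    have "g permutes {0}" by (rule permutes_subset[OF 0(2)]) auto
    then have g: "g = id" by simp
    show ?case unfolding g esc_id by simp
  next
    case (Suc m)
    show ?case
    proof (cases "a \<le> Suc m")
      case True
      \<comment> \<open>Composing with \<open>?t\<close> makes \<open>Suc m\<close> a fixed point
        and leaves a permutation of \<open>{a..m}\<close>. Hence at most \<open>n\<close>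
        transpositions are used, each of cost at most \<open>2 * n * M\<close>.\<close>
      let ?t = "transpose (Suc m) (g (Suc m))"
      have "{a..Suc m} = insert (Suc m) {a..m}" using True by auto
      then have p: "?t \<circ> g permutes {a..m}" using Suc(3) permutes_insert_lemma by metis
      have gm: "g (Suc m) \<in> {a..Suc m}" using permutes_in_image[OF Suc(3)] True by simp
      have "g = ?t \<circ> (?t \<circ> g)" by (simp add: comp_assoc[symmetric])
      then have "esc g \<le> esc ?t + esc (?t \<circ> g)" using esc_comp[OF tr] by metis
      also have "\<dots> \<le> 2 * n * M + 2 * n * m * M"
        using Suc(2) True gm by (intro add_mono swap Suc(1)[OF _ p]) auto
      finally show ?thesis by (simp add: algebra_simps)
    next
      case False
      then have g: "g = id" using Suc(3) by simp
      show ?thesis unfolding g esc_id by simp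
    qed
  qed
  from this[OF order.refl g] show ?thesis by (simp add: esc_def)
qed

section \<open>Double counting\<close>

lemma card_le_fibres:
  assumes D: "finite D" and f: "\<And>z. z \<in> S \<Longrightarrow> f z \<in> D" and fib: "\<And>p. p \<in> D \<Longrightarrow> card {z \<in> S. f z = p} \<le> k"
  shows "card S \<le> k * card D"
proof -
  have "S = (\<Union>p\<in>D. {z \<in> S. f z = p})" using f by blast
  then have "card S \<le> (\<Sum>p\<in>D. card {z \<in> S. f z = p})"
    using card_UN_le[OF D, of "\<lambda>p. {z \<in> S. f z = p}"] by simp
  also have "\<dots> \<le> (\<Sum>p\<in>D. k)" by (rule sum_mono) (rule fib)
  finally show ?thesis by (simp add: mult.commute)
qed

text \<open>Forgetting the order is at most two-to-one, and \<open>{} \<notin> \<A>\<close> makes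
  disjoint members distinct, as \<open>disjoint_pairs\<close> requires.\<close>

lemma card_ordered_disjoint_pairs:
  assumes fin: "finite \<A>" and ne: "{} \<notin> \<A>"
  shows "card {(X, Y). X \<in> \<A> \<and> Y \<in> \<A> \<and> X \<inter> Y = {}} \<le> 2 * disjoint_pairs \<A>"
proof -
  let ?O = "{(X, Y). X \<in> \<A> \<and> Y \<in> \<A> \<and> X \<inter> Y = {}}"
  let ?D = "{{X, Y} | X Y. X \<in> \<A> \<and> Y \<in> \<A> \<and> X \<noteq> Y \<and> X \<inter> Y = {}}"
  let ?f = "\<lambda>(X, Y). {X, Y}"
  have finO: "finite ?O" by (rule finite_subset[of _ "\<A> \<times> \<A>"]) (use fin in auto)
  have finD: "finite ?D" by (rule finite_subset[of _ "Pow \<A>"]) (use fin in auto)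
  have fib: "card {z \<in> ?O. ?f z = p} \<le> 2" if "p \<in> ?D" for p
  proof -
    obtain X Y where p: "p = {X, Y}" using \<open>p \<in> ?D\<close> by blast
    have "card {z \<in> ?O. ?f z = p} \<le> card {(X, Y), (Y, X)}"
    proof (intro card_mono subsetI)
      fix z assume "z \<in> {z \<in> ?O. ?f z = p}"
      then have "{fst z, snd z} = {X, Y}" unfolding p by (cases z) simp
      then show "z \<in> {(X, Y), (Y, X)}" by (cases z) (simp only: doubleton_eq_iff, auto)
    qed simp
    also have "\<dots> \<le> 2" using card_length[of "[(X, Y), (Y, X)]"] by simp
    finally show ?thesis .
  qed
  have "?f z \<in> ?D" if "z \<in> ?O" for z
  proof -
    obtain X Y where z: "z = (X, Y)" "X \<in> \<A>" "Y \<in> \<A>" "X \<inter> Y = {}" using \<open>z \<in> ?O\<close> by blast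
    then have "X \<noteq> Y" using ne by (metis Int_absorb)
    with z show ?thesis by auto
  qed
  from card_le_fibres[OF finD this fib] show ?thesis by (simp only: disjoint_pairs_def)
qed

lemma sum_card_swap:
  assumes "finite S" "finite T"
  shows "(\<Sum>x\<in>S. card {y \<in> T. R x y}) = (\<Sum>y\<in>T. card {x \<in> S. R x y})"
  using sum.swap_restrict[OF assms, of "\<lambda>_ _. 1::nat" R] by simp

lemma sum_of_bool_Collect:
  assumes "finite {x. Q x}"
  shows "(\<Sum>x | Q x. of_bool (P x)) = card {x. Q x \<and> P x}"
  using assms by (simp add: Int_def)

section \<open>Counts of centred, bad and good orders\<close>

context cyclic_arcs
begin

abbreviation Perms :: "(nat \<Rightarrow> nat) set" where
  "Perms \<equiv> {\<sigma>. \<sigma> permutes {1..n}}"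

lemma finite_Perms [simp]: "finite Perms"
  by (simp add: finite_permutations)

lemma card_Perms [simp]: "card Perms = fact n"
  by (simp add: card_permutations)

lemma finite_Perms_sub: "finite {\<sigma>. \<sigma> permutes {1..n} \<and> P \<sigma>}"
  by (rule finite_subset[OF _ finite_Perms]) auto

declare finite_Perms_sub [unfolded One_nat_def, simp]

lemma finite_family: "finite \<A>"
  by (rule finite_subset[OF uniform]) simp

lemma empty_notin: "{} \<notin> \<A>"
  using uniform r_pos by auto

lemma finite_centred: "finite (centred x)"
  unfolding centred_def by (rule finite_Perms_sub)

text \<open>Fix \<open>\<sigma>\<close> centred at \<open>x\<close>. Every order with
  \<open>x\<close> at position \<open>1\<close> is \<open>\<sigma> \<circ> g\<close> for some
  \<open>g\<close> permuting \<open>{2..n}\<close>, and it is not centred if its arc at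
  \<open>1\<close> is in the family; so \<open>\<sigma>\<close> escapes under at least as many
  \<open>g\<close> as there are such orders. Summing over \<open>g\<close> instead,
  \<open>card_escape_le\<close> bounds the escapes, since an adjacent swap leaves
  \<open>centred x\<close> only towards an order that is not good.\<close>

lemma card_centred_mult:
  "card (centred x) * card {\<sigma>. \<sigma> permutes {1..n} \<and> \<sigma> 1 = x \<and> arc \<sigma> 1 \<in> \<A>}
    \<le> fact (n - 1) * (2 * n * n * card {\<sigma>. \<sigma> permutes {1..n} \<and> \<not> good \<sigma>})"
proof -
  let ?E = "centred x" and ?T = "{\<sigma>. \<sigma> permutes {1..n} \<and> \<sigma> 1 = x \<and> arc \<sigma> 1 \<in> \<A>}"
  let ?H = "{g. g permutes {2..n}}" and ?M = "card {\<sigma>. \<sigma> permutes {1..n} \<and> \<not> good \<sigma>}"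
  have finH: "finite ?H" by (simp add: finite_permutations)
  have T: "card ?T \<le> card {g \<in> ?H. \<sigma> \<circ> g \<notin> ?E}" if s: "\<sigma> \<in> ?E" for \<sigma>
  proof (rule card_inj_on_le[of "\<lambda>\<tau>. inv \<sigma> \<circ> \<tau>"])
    have sp: "\<sigma> permutes {1..n}" "\<sigma> 1 = x" using s by (simp_all add: centred_def)
    have canc: "\<sigma> \<circ> (inv \<sigma> \<circ> \<tau>) = \<tau>" for \<tau> :: "nat \<Rightarrow> nat"
      using permutes_inv_o(1)[OF sp(1)] by (simp add: comp_assoc[symmetric])
    show "inj_on (\<lambda>\<tau>. inv \<sigma> \<circ> \<tau>) ?T"
    proof (rule inj_onI)
      fix \<tau> \<upsilon> :: "nat \<Rightarrow> nat" assume "inv \<sigma> \<circ> \<tau> = inv \<sigma> \<circ> \<upsilon>"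
      then have "\<sigma> \<circ> (inv \<sigma> \<circ> \<tau>) = \<sigma> \<circ> (inv \<sigma> \<circ> \<upsilon>)" by (rule arg_cong)
      then show "\<tau> = \<upsilon>" by (simp only: canc)
    qed
    show "(\<lambda>\<tau>. inv \<sigma> \<circ> \<tau>) ` ?T \<subseteq> {g \<in> ?H. \<sigma> \<circ> g \<notin> ?E}"
    proof (rule image_subsetI)
      fix \<tau> assume t: "\<tau> \<in> ?T"
      then have "inv \<sigma> \<circ> \<tau> permutes {1..n}" using permutes_compose[OF _ permutes_inv[OF sp(1)]] by blast
      moreover have "(inv \<sigma> \<circ> \<tau>) 1 = 1" using t sp permutes_inverses(2)[OF sp(1), of 1] by auto
      moreover have "v = 1" if "v \<in> {1..n} - {2..n}" for v using that by auto
      ultimately have "inv \<sigma> \<circ> \<tau> permutes {2..n}" by (metis permutes_superset)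
      moreover have "\<tau> \<notin> ?E" using t by (simp add: centred_def)
      ultimately show "inv \<sigma> \<circ> \<tau> \<in> {g \<in> ?H. \<sigma> \<circ> g \<notin> ?E}" by (simp add: canc)
    qed
  qed (use finH in simp)
  have adj: "card {\<sigma> \<in> ?E. \<sigma> \<circ> transpose v (Suc v) \<notin> ?E} \<le> ?M" if v: "2 \<le> v" "v < n" for v
  proof (rule card_inj_on_le[of "\<lambda>\<sigma>. \<sigma> \<circ> transpose v (Suc v)"])
    have tp: "transpose v (Suc v) permutes {1..n}" using v by (intro permutes_swap_id) auto
    show "inj_on (\<lambda>\<sigma>. \<sigma> \<circ> transpose v (Suc v)) {\<sigma> \<in> ?E. \<sigma> \<circ> transpose v (Suc v) \<notin> ?E}"
      using comp_permutes_cancel[OF tp] by (intro inj_onI) auto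
    \<comment> \<open>Position \<open>v\<close> has index \<open>v - 1\<close>, so
      \<open>2 \<le> v < n\<close> is the range of swaps allowed in
      \<open>centred_step\<close>.\<close>
    have pv: "pos (int v - 1) = v" "pos (int v - 1 + 1) = Suc v" using v by (simp_all add: pos_small)
    show "(\<lambda>\<sigma>. \<sigma> \<circ> transpose v (Suc v)) ` {\<sigma> \<in> ?E. \<sigma> \<circ> transpose v (Suc v) \<notin> ?E}
      \<subseteq> {\<sigma>. \<sigma> permutes {1..n} \<and> \<not> good \<sigma>}"
    proof (rule image_subsetI)
      fix \<sigma> assume s: "\<sigma> \<in> {\<sigma> \<in> ?E. \<sigma> \<circ> transpose v (Suc v) \<notin> ?E}"
      then have "\<sigma> \<circ> transpose v (Suc v) permutes {1..n}"
        using tp by (auto simp: centred_def intro: permutes_compose)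
      moreover have "\<not> good (\<sigma> \<circ> transpose v (Suc v))"
        using centred_step[of \<sigma> x "int v - 1"] s v unfolding pv by auto
      ultimately show "\<sigma> \<circ> transpose v (Suc v) \<in> {\<sigma>. \<sigma> permutes {1..n} \<and> \<not> good \<sigma>}" by simp
    qed
  qed simp
  have "card ?E * card ?T = (\<Sum>\<sigma>\<in>?E. card ?T)" by simp
  also have "\<dots> \<le> (\<Sum>\<sigma>\<in>?E. card {g \<in> ?H. \<sigma> \<circ> g \<notin> ?E})" by (intro sum_mono T)
  also have "\<dots> = (\<Sum>g\<in>?H. card {\<sigma> \<in> ?E. \<sigma> \<circ> g \<notin> ?E})"
    by (rule sum_card_swap[OF finite_centred finH])
  also have "\<dots> \<le> (\<Sum>g\<in>?H. 2 * n * n * ?M)"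
    using card_escape_le[OF finite_centred adj] by (intro sum_mono) simp
  also have "\<dots> = fact (n - 1) * (2 * n * n * ?M)"
    using card_permutations[of "{2..n}" "n - 1"] by simp
  finally show ?thesis .
qed

text \<open>Position \<open>1\<close> lies just before the arc at \<open>1\<close>, so
  \<open>\<sigma> 1 = x\<close> forces a member on that arc to avoid \<open>x\<close>, and each
  member avoiding \<open>x\<close> arises from equally many orders.\<close>

lemma card_avoiding:
  assumes x: "x \<in> {1..n}"
  shows "card {X \<in> \<A>. x \<notin> X} * fact (n - 1)
    = card {\<sigma>. \<sigma> permutes {1..n} \<and> \<sigma> 1 = x \<and> arc \<sigma> 1 \<in> \<A>} * ((n - 1) choose r)"
proof -
  let ?D = "{X \<in> \<A>. x \<notin> X}" and ?T = "{\<sigma>. \<sigma> permutes {1..n} \<and> \<sigma> 1 = x \<and> arc \<sigma> 1 \<in> \<A>}"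
  let ?Q = "pos ` {1..<1 + int r}"
  let ?F = "\<lambda>X. {\<sigma>. \<sigma> permutes {1..n} \<and> \<sigma> ` {1} = {x} \<and> \<sigma> ` ?Q = X}"
  have Q: "?Q \<subseteq> {1..n}" "card ?Q = r" using pos_in card_pos_arc[of 1] by auto
  have one: "1 \<notin> ?Q"
    using pos_mem_iff[of 0 0 1] n_ge by (simp add: pos_small)
  have cF: "card (?F X) * (n * ((n - 1) choose r)) = fact n" if "X \<in> ?D" for X
    using card_permutes_mapping_pair[of "{1..n}" "{1}" ?Q "{x}" X] that x Q one uniform n_ge
    by auto
  have "?T = (\<Union>X\<in>?D. ?F X)"
  proof (intro equalityI subsetI)
    fix \<sigma> assume s: "\<sigma> \<in> ?T"
    then have "x \<notin> arc \<sigma> 1"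
      using one permutes_inj[of \<sigma> "{1..n}"] by (auto simp: arc_def inj_def)
    with s show "\<sigma> \<in> (\<Union>X\<in>?D. ?F X)" by (auto simp: arc_def)
  qed (auto simp: arc_def)
  then have "card ?T = card (\<Union>X\<in>?D. ?F X)" by simp
  also have "\<dots> = (\<Sum>X\<in>?D. card (?F X))"
    using finite_family by (intro card_UN_disjoint) auto
  finally have "card ?T * (n * ((n - 1) choose r)) = (\<Sum>X\<in>?D. fact n)"
    using cF by (simp add: sum_distrib_right)
  moreover have "fact n = n * (fact (n - 1) :: nat)" using n_ge by (simp add: fact_reduce)
  ultimately have "n * (card ?T * ((n - 1) choose r)) = n * (card ?D * fact (n - 1))"
    by (simp add: mult_ac)
  then show ?thesis using n_ge by simp
qed

text \<open>A bad order is witnessed by a start modulo \<open>n\<close>, a distance and an ordered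
  disjoint pair: at most \<open>n * n * (2 * disjoint_pairs \<A>)\<close> choices. Prescribing the
  sets on both arcs leaves \<open>fact n\<close> divided by the two binomials.\<close>

lemma card_bad_le:
  "card {\<sigma>. \<sigma> permutes {1..n} \<and> bad \<sigma>} * ((n choose r) * ((n - r) choose r))
    \<le> 2 * n * n * disjoint_pairs \<A> * fact n"
proof -
  let ?O = "{(X, Y). X \<in> \<A> \<and> Y \<in> \<A> \<and> X \<inter> Y = {}}"
  let ?K = "{0..<int n} \<times> {int r..int n - int r} \<times> ?O"
  let ?c = "(n choose r) * ((n - r) choose r)"
  define F where "F = (\<lambda>(i, d, X, Y). {\<sigma>. \<sigma> permutes {1..n} \<and> arc \<sigma> i = X \<and> arc \<sigma> (i + d) = Y})"
  have cF: "card (F z) * ?c = fact n" if z: "z \<in> ?K" for z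
  proof -
    obtain i d X Y where z': "z = (i, d, X, Y)" by (cases z) auto
    have d: "int r \<le> d" "d \<le> int n - int r" and XY: "X \<in> \<A>" "Y \<in> \<A>" "X \<inter> Y = {}" using z z' by auto
    have P: "pos ` {j..<j + int r} \<subseteq> {1..n}" for j using pos_in by blast
    have r: "X \<subseteq> {1..n}" "card X = r" "Y \<subseteq> {1..n}" "card Y = r" using XY uniform by auto
    have "pos ` {i..<i + int r} \<inter> pos ` {i + d..<i + d + int r} = {}"
      using d by (intro pos_arc_disjoint) auto
    then show ?thesis
      using card_permutes_mapping_pair[of "{1..n}" "pos ` {i..<i + int r}" "pos ` {i + d..<i + d + int r}" X Y]
        P XY r by (simp add: F_def z' arc_def card_pos_arc)
  qed
  have finO: "finite ?O" by (rule finite_subset[of _ "\<A> \<times> \<A>"]) (use finite_family in auto)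
  then have finK: "finite ?K" by simp
  have "{\<sigma>. \<sigma> permutes {1..n} \<and> bad \<sigma>} \<subseteq> (\<Union>z\<in>?K. F z)"
  proof
    fix \<sigma> assume s: "\<sigma> \<in> {\<sigma>. \<sigma> permutes {1..n} \<and> bad \<sigma>}"
    then obtain i j where ij: "i + int r \<le> j" "j + int r \<le> i + int n" "arc \<sigma> i \<in> \<A>" "arc \<sigma> j \<in> \<A>"
      by (auto simp: bad_def)
    have "arc \<sigma> (i mod int n + (j - i)) = arc \<sigma> j" by (rule arc_cong) (simp add: mod_add_left_eq)
    moreover have "arc \<sigma> i \<inter> arc \<sigma> j = {}"
      using pos_arc_disjoint[OF ij(1,2)] s unfolding arc_def
      by (metis (no_types, lifting) image_Int image_empty mem_Collect_eq permutes_inj)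
    ultimately have "(i mod int n, j - i, arc \<sigma> i, arc \<sigma> j) \<in> ?K"
      "\<sigma> \<in> F (i mod int n, j - i, arc \<sigma> i, arc \<sigma> j)"
      using ij n_pos s by (auto simp: F_def)
    then show "\<sigma> \<in> (\<Union>z\<in>?K. F z)" by blast
  qed
  then have "card {\<sigma>. \<sigma> permutes {1..n} \<and> bad \<sigma>} \<le> card (\<Union>z\<in>?K. F z)"
    using finK by (intro card_mono) (auto simp: F_def)
  also have "\<dots> \<le> (\<Sum>z\<in>?K. card (F z))" by (rule card_UN_le[OF finK])
  finally have "card {\<sigma>. \<sigma> permutes {1..n} \<and> bad \<sigma>} * ?c \<le> (\<Sum>z\<in>?K. card (F z)) * ?c"
    by (rule mult_right_mono) simp
  also have "\<dots> = (\<Sum>z\<in>?K. fact n)"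
    unfolding sum_distrib_right using cF by (intro sum.cong) auto
  also have "\<dots> = card ?K * fact n" by simp
  also have "card ?K = n * (card {int r..int n - int r} * card ?O)"
    by (simp add: card_cartesian_product)
  also have "\<dots> \<le> n * (n * (2 * disjoint_pairs \<A>))"
    using card_ordered_disjoint_pairs[OF finite_family empty_notin] r_pos
    by (intro mult_mono) auto
  finally show ?thesis by (simp add: mult_ac)
qed

text \<open>By the size of the family the mean number of member arcs is exactly \<open>r\<close>.
  Orders that are neither good nor bad fall below this mean, and only bad orders, with at most
  \<open>n\<close> member arcs each, can make up for it.\<close>

lemma card_not_good_le:
  assumes card_A: "card \<A> = (n - 1) choose (r - 1)"
  shows "card {\<sigma>. \<sigma> permutes {1..n} \<and> \<not> good \<sigma>} \<le> n * card {\<sigma>. \<sigma> permutes {1..n} \<and> bad \<sigma>}"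
proof -
  let ?I = "\<lambda>\<sigma>. {k \<in> {0..<int n}. arc \<sigma> k \<in> \<A>}"
  have fib: "card {\<sigma> \<in> Perms. arc \<sigma> k \<in> \<A>} * (n choose r) = card \<A> * fact n" for k
  proof -
    let ?F = "\<lambda>X. {\<sigma>. \<sigma> permutes {1..n} \<and> \<sigma> ` pos ` {k..<k + int r} = X}"
    have cF: "card (?F X) * (n choose r) = fact n" if "X \<in> \<A>" for X
    proof -
      have "X \<subseteq> {1..n}" "card X = r" "pos ` {k..<k + int r} \<subseteq> {1..n}" using that uniform pos_in by blast+
      then show ?thesis
        using card_permutes_mapping[of "{1..n}" "pos ` {k..<k + int r}" X] by (simp add: card_pos_arc)
    qed
    have "{\<sigma> \<in> Perms. arc \<sigma> k \<in> \<A>} = (\<Union>X\<in>\<A>. ?F X)" by (auto simp: arc_def)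
    then have "card {\<sigma> \<in> Perms. arc \<sigma> k \<in> \<A>} = card (\<Union>X\<in>\<A>. ?F X)" by simp
    also have "\<dots> = (\<Sum>X\<in>\<A>. card (?F X))"
      using finite_family by (intro card_UN_disjoint) auto
    finally show ?thesis using cF by (simp add: sum_distrib_right)
  qed
  have "(\<Sum>\<sigma>\<in>Perms. card (?I \<sigma>)) * (n choose r) = (\<Sum>k\<in>{0..<int n}. card {\<sigma> \<in> Perms. arc \<sigma> k \<in> \<A>}) * (n choose r)"
    using sum_card_swap[OF finite_Perms, of "{0..<int n}" "\<lambda>\<sigma> k. arc \<sigma> k \<in> \<A>"] by simp
  also have "\<dots> = n * (card \<A> * fact n)"
    unfolding sum_distrib_right fib by simp
  also have "\<dots> = (n * ((n - 1) choose (r - 1))) * fact n" by (simp add: card_A)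
  also have "n * ((n - 1) choose (r - 1)) = r * (n choose r)"
    using times_binomial_minus1_eq[of r n] r_pos by simp
  finally have "(\<Sum>\<sigma>\<in>Perms. card (?I \<sigma>)) * (n choose r) = (r * fact n) * (n choose r)"
    by (simp add: mult_ac)
  moreover have "0 < n choose r" using n_ge by (intro zero_less_binomial) simp
  ultimately have mean: "(\<Sum>\<sigma>\<in>Perms. card (?I \<sigma>)) = r * fact n" by simp
  have pt: "card (?I \<sigma>) + of_bool (\<not> good \<sigma>) \<le> r + n * of_bool (bad \<sigma>)" for \<sigma>
  proof (cases "bad \<sigma>")
    case True
    \<comment> \<open>The term \<open>1 \<le> r\<close> pays for a bad order also being counted as
      not good.\<close>
    have "card (?I \<sigma>) \<le> card {0..<int n}" by (intro card_mono) auto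
    then show ?thesis using True r_pos by simp
  next
    case False
    show ?thesis
    proof (cases "good \<sigma>")
      case True then show ?thesis using katona_bound[OF False] by simp
    next
      case ng: False
      then have "card (?I \<sigma>) < r" using good_if_full[OF False] not_le by blast
      then show ?thesis by simp
    qed
  qed
  have count: "(\<Sum>\<sigma>\<in>Perms. of_bool (P \<sigma>)) = card {\<sigma>. \<sigma> permutes {1..n} \<and> P \<sigma>}" for P
    by (rule sum_of_bool_Collect[OF finite_Perms])
  have "(\<Sum>\<sigma>\<in>Perms. card (?I \<sigma>) + of_bool (\<not> good \<sigma>)) \<le> (\<Sum>\<sigma>\<in>Perms. r + n * of_bool (bad \<sigma>))"
    by (rule sum_mono) (rule pt)
  then have "(\<Sum>\<sigma>\<in>Perms. card (?I \<sigma>)) + (\<Sum>\<sigma>\<in>Perms. of_bool (\<not> good \<sigma>))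
      \<le> (\<Sum>\<sigma>\<in>Perms. r) + n * (\<Sum>\<sigma>\<in>Perms. of_bool (bad \<sigma>))"
    by (simp only: sum.distrib sum_distrib_left)
  moreover have "(\<Sum>\<sigma>\<in>Perms. r) = r * fact n" by (simp only: sum_constant card_Perms of_nat_id mult.commute)
  ultimately show ?thesis unfolding mean count by linarith
qed

text \<open>At least half of the orders are good. One factor \<open>n\<close> comes from rotating
  the last start of the run to index \<open>0\<close>, the other from averaging over the value at
  position \<open>1\<close>.\<close>

lemma ex_centre:
  assumes "2 * card {\<sigma>. \<sigma> permutes {1..n} \<and> \<not> good \<sigma>} \<le> fact n"
  obtains x where "x \<in> {1..n}" "fact n \<le> 2 * n * n * card (centred x)"
proof -
  let ?G = "{\<sigma>. \<sigma> permutes {1..n} \<and> good \<sigma>}"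
  let ?L = "\<lambda>p. {\<sigma>. \<sigma> permutes {1..n} \<and> good \<sigma> \<and> arc \<sigma> p \<in> \<A> \<and> arc \<sigma> (p + 1) \<notin> \<A>}"
  have L: "card (?L p) \<le> card (?L 0)" for p
  proof (rule card_inj_on_le[of "\<lambda>\<sigma>. \<sigma> \<circ> rot p"])
    show "inj_on (\<lambda>\<sigma>. \<sigma> \<circ> rot p) (?L p)"
      using comp_permutes_cancel[OF rot_permutes] by (intro inj_onI) auto
    show "(\<lambda>\<sigma>. \<sigma> \<circ> rot p) ` ?L p \<subseteq> ?L 0"
      using rot_permutes by (auto simp: arc_rot good_rot add.commute intro: permutes_compose)
  qed simp
  have split: "Perms = {\<sigma>. \<sigma> permutes {1..n} \<and> \<not> good \<sigma>} \<union> ?G" by auto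
  have "fact n \<le> card {\<sigma>. \<sigma> permutes {1..n} \<and> \<not> good \<sigma>} + card ?G"
    unfolding card_Perms[symmetric] split by (rule card_Un_le)
  then have "fact n \<le> 2 * card ?G" using assms by simp
  also have "card ?G \<le> card (\<Union>p\<in>{0..<int n}. ?L p)"
  proof (intro card_mono subsetI)
    fix \<sigma> assume s: "\<sigma> \<in> ?G"
    then obtain p where "p \<in> {0..<int n}" "arc \<sigma> p \<in> \<A>" "arc \<sigma> (p + 1) \<notin> \<A>" using ex_last by blast
    with s show "\<sigma> \<in> (\<Union>p\<in>{0..<int n}. ?L p)" by blast
  qed simp
  also have "\<dots> \<le> (\<Sum>p\<in>{0..<int n}. card (?L p))" by (rule card_UN_le) simp
  also have "\<dots> \<le> (\<Sum>p\<in>{0..<int n}. card (?L 0))" by (intro sum_mono L)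
  also have "\<dots> = n * card (?L 0)" by simp
  also have "card (?L 0) \<le> card (\<Union>x\<in>{1..n}. centred x)"
  proof (intro card_mono subsetI)
    fix \<sigma> assume s: "\<sigma> \<in> ?L 0"
    then have "\<sigma> 1 \<in> {1..n}" using permutes_in_image[of \<sigma> "{1..n}" 1] n_ge by simp
    then show "\<sigma> \<in> (\<Union>x\<in>{1..n}. centred x)" using s by (auto simp: centred_def)
  qed (simp add: finite_centred)
  also have "\<dots> \<le> (\<Sum>x\<in>{1..n}. card (centred x))" by (rule card_UN_le) simp
  finally have main: "fact n \<le> 2 * (n * (\<Sum>x\<in>{1..n}. card (centred x)))" by simp
  show thesis
  proof (rule ccontr)
    assume "\<not> thesis"
    then have lt: "2 * n * n * card (centred x) < fact n" if "x \<in> {1..n}" for x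
      using that \<open>\<And>x. \<lbrakk>x \<in> {1..n}; fact n \<le> 2 * n * n * card (centred x)\<rbrakk> \<Longrightarrow> thesis\<close> not_less by blast
    have "n * fact n \<le> (\<Sum>x\<in>{1..n}. 2 * n * n * card (centred x))"
      using main by (simp add: sum_distrib_left[symmetric] mult_ac)
    also have "\<dots> < (\<Sum>x\<in>{1..n}. fact n)"
      using lt n_ge by (intro sum_strict_mono) auto
    finally show False by simp
  qed
qed

text \<open>The star at \<open>x\<close> inside the family is an intersecting subfamily.\<close>

lemma intersecting_distance_le:
  "intersecting_distance \<A> \<le> card {X \<in> \<A>. x \<notin> X}"
proof -
  have fin: "finite {\<B>. \<B> \<subseteq> \<A> \<and> intersecting \<B>}"
    by (rule finite_subset[of _ "Pow \<A>"]) (use finite_family in auto)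
  have "intersecting {X \<in> \<A>. x \<in> X}" by (auto simp: intersecting_def)
  then have "card {X \<in> \<A>. x \<in> X} \<le> Max (card ` {\<B>. \<B> \<subseteq> \<A> \<and> intersecting \<B>})"
    using fin by (intro Max_ge) auto
  moreover have "card \<A> = card {X \<in> \<A>. x \<in> X} + card {X \<in> \<A>. x \<notin> X}"
    using finite_family by (subst card_Un_disjoint[symmetric]) (auto intro: arg_cong[of _ _ card])
  ultimately show ?thesis unfolding intersecting_distance_def by linarith
qed

text \<open>If at most half of the orders fail to be good, there is a popular centre
  \<open>x\<close>, and \<open>card_centred_mult\<close> with \<open>card_avoiding\<close> bounds
  the members avoiding \<open>x\<close>. Otherwise the failures are so many that the trivial bound
  \<open>n choose r\<close> on the distance suffices.\<close>

lemma disjoint_pairs_lower_bound: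
  assumes card_A: "card \<A> = (n - 1) choose (r - 1)"
  shows "intersecting_distance \<A> * ((n - r) choose r) \<le> 8 * n ^ 7 * disjoint_pairs \<A>"
proof -
  define M where "M = card {\<sigma>. \<sigma> permutes {1..n} \<and> \<not> good \<sigma>}"
  define B where "B = card {\<sigma>. \<sigma> permutes {1..n} \<and> bad \<sigma>}"
  define e l c where "e = disjoint_pairs \<A>" and "l = intersecting_distance \<A>" and "c = (n - r) choose r"
  have n0: "0 < n" using n_ge by simp
  have MB: "M \<le> n * B" using card_not_good_le[OF card_A] by (simp add: M_def B_def)
  have Be: "B * ((n choose r) * c) \<le> 2 * n * n * e * fact n"
    using card_bad_le by (simp add: B_def c_def e_def)
  have Me: "M * ((n choose r) * c) \<le> 2 * n ^ 3 * e * fact n"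
  proof -
    have "M * ((n choose r) * c) \<le> n * (B * ((n choose r) * c))" using MB by (simp add: mult_ac)
    also have "\<dots> \<le> n * (2 * n * n * e * fact n)" using Be by simp
    finally show ?thesis by (simp add: power3_eq_cube mult_ac)
  qed
  show ?thesis
  proof (cases "2 * M \<le> fact n")
    case True
    then obtain x where x: "x \<in> {1..n}" "fact n \<le> 2 * n * n * card (centred x)"
      using ex_centre unfolding M_def by blast
    define T where "T = card {\<sigma>. \<sigma> permutes {1..n} \<and> \<sigma> 1 = x \<and> arc \<sigma> 1 \<in> \<A>}"
    have "fact n * T \<le> 2 * n * n * (card (centred x) * T)"
      using mult_right_mono[OF x(2), of T] by (simp add: mult_ac)
    also have "\<dots> \<le> 2 * n * n * (fact (n - 1) * (2 * n * n * M))"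
      using card_centred_mult by (intro mult_left_mono) (simp_all add: T_def M_def)
    also have "\<dots> = fact n * (4 * n ^ 3 * M)"
      using n0 by (simp add: fact_reduce[of n] power3_eq_cube)
    \<comment> \<open>The centre and the escape bound contribute \<open>n ^ 4\<close>, of which
      \<open>fact n = n * fact (n - 1)\<close> takes one factor back. Below, \<open>Me\<close> adds
      \<open>n ^ 3\<close> and the same identity returns one \<open>n\<close>, for
      \<open>n ^ 7\<close> in total.\<close>
    finally have TM: "T \<le> 4 * n ^ 3 * M" by simp
    have "l * fact (n - 1) \<le> card {X \<in> \<A>. x \<notin> X} * fact (n - 1)"
      unfolding l_def by (intro mult_right_mono intersecting_distance_le) simp
    also have "\<dots> = T * ((n - 1) choose r)" unfolding T_def by (rule card_avoiding[OF x(1)])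
    also have "\<dots> \<le> (4 * n ^ 3 * M) * (n choose r)"
      by (intro mult_mono TM binomial_right_mono) auto
    finally have "l * fact (n - 1) * c \<le> 4 * n ^ 3 * M * (n choose r) * c" by simp
    also have "\<dots> = 4 * n ^ 3 * (M * ((n choose r) * c))" by simp
    also have "\<dots> \<le> 4 * n ^ 3 * (2 * n ^ 3 * e * fact n)" by (rule mult_left_mono[OF Me]) simp
    also have "\<dots> = fact (n - 1) * (8 * n ^ 7 * e)"
      using n0 by (simp add: fact_reduce[of n] flip: power_add) (simp add: eval_nat_numeral)
    finally show ?thesis by (simp add: l_def c_def e_def)
  next
    case False
    have "l \<le> card \<A>" by (simp add: l_def intersecting_distance_def)
    also have "\<dots> \<le> card {X. X \<subseteq> {1..n} \<and> card X = r}" by (intro card_mono uniform) simp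
    also have "\<dots> = n choose r" by (simp add: n_subsets)
    finally have "fact n * (l * c) \<le> (2 * M) * ((n choose r) * c)"
      using False by (intro mult_mono) auto
    also have "\<dots> = 2 * (M * ((n choose r) * c))" by simp
    also have "\<dots> \<le> 2 * (2 * n ^ 3 * e * fact n)" by (rule mult_left_mono[OF Me]) simp
    also have "\<dots> = fact n * (4 * n ^ 3 * e)" by simp
    finally have "l * c \<le> 4 * n ^ 3 * e" by simp
    also have "\<dots> \<le> 8 * n ^ 7 * e" using n0 by (intro mult_mono power_increasing) auto
    finally show ?thesis by (simp add: l_def c_def e_def)
  qed
qed

end

section \<open>Exponential estimates\<close>

lemma eventually_poly_le_exp:
  fixes b :: real
  assumes "1 < b"
  shows "\<exists>N. \<forall>n\<ge>N. 8 * real n ^ 7 \<le> b powr real n"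
proof -
  define k where "k = ln b"
  have "k > 0" using assms by (simp add: k_def)
  then have "eventually (\<lambda>n::nat. 8 * real n ^ 7 \<le> exp (k * real n)) at_top"
    by real_asymp
  then show ?thesis
    using assms by (simp add: eventually_at_top_linorder powr_def k_def mult.commute)
qed

text \<open>The binomial is at least \<open>((n - r) / r) ^ r\<close>, and the ratio is at least
  \<open>1 + 2 * \<epsilon>\<close> because
  \<open>(1 + 2 * \<epsilon>) * (1 / 2 - \<epsilon>) \<le> 1 / 2\<close> while \<open>n - r\<close>
  is at least \<open>n / 2\<close>.\<close>

lemma choose_exponential:
  fixes \<epsilon> :: real
  assumes "0 < \<epsilon>" "\<epsilon> * real n \<le> real r" "real r \<le> (1 / 2 - \<epsilon>) * real n" "1 \<le> r"
  shows "(1 + 2 * \<epsilon>) powr (\<epsilon> * real n) \<le> real ((n - r) choose r)"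
proof -
  have "(1 + 2 * \<epsilon>) * real r \<le> (1 + 2 * \<epsilon>) * ((1 / 2 - \<epsilon>) * real n)"
    using assms by (intro mult_left_mono) auto
  also have "\<dots> = real n / 2 - 2 * (\<epsilon> * \<epsilon> * real n)" by (simp add: algebra_simps)
  also have "\<dots> \<le> real n / 2" using assms by simp
  also have "\<dots> \<le> real n - real r"
  proof -
    have "0 \<le> \<epsilon> * real n" using assms(1) by simp
    then show ?thesis using assms(3) by (simp add: algebra_simps)
  qed
  finally have q: "(1 + 2 * \<epsilon>) * real r \<le> real n - real r" .
  have "1 * real r \<le> (1 + 2 * \<epsilon>) * real r" using assms by (intro mult_right_mono) auto
  with q have r: "2 * r \<le> n" by linarith
  have "(1 + 2 * \<epsilon>) powr (\<epsilon> * real n) \<le> (1 + 2 * \<epsilon>) powr real r"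
    using assms by (intro powr_mono) auto
  also have "\<dots> = (1 + 2 * \<epsilon>) ^ r" using assms by (simp add: powr_realpow)
  also have "\<dots> \<le> (real (n - r) / real r) ^ r"
    using assms q r by (intro power_mono) (auto simp: pos_le_divide_eq of_nat_diff)
  also have "\<dots> \<le> real ((n - r) choose r)"
    using binomial_ge_n_over_k_pow_k[of r "n - r", where 'a = real] r by simp
  finally show ?thesis .
qed

lemma intersecting_distance_le_power:
  assumes "uniform_family n r \<A>"
  shows "intersecting_distance \<A> \<le> 2 ^ n"
proof -
  have "card \<A> \<le> card (Pow {1..n})"
    using assms by (intro card_mono) (auto simp: uniform_family_def)
  then show ?thesis by (simp add: intersecting_distance_def card_Pow)
qed

theorem lemma3p4:
  shows "\<forall>\<epsilon>::real. \<epsilon> > 0 \<longrightarrow> (\<exists>C::real. C > 0 \<and> (\<forall>\<eta>::real. \<eta> > 0 \<longrightarrow> (\<exists>\<delta>::real. \<delta> > 0 \<and>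
    (\<forall>(n::nat) (r::nat) (\<A> :: nat set set).
       1 \<le> n \<longrightarrow> \<epsilon> * real n \<le> real r \<longrightarrow> real r \<le> (1 / 2 - \<epsilon>) * real n \<longrightarrow>
       uniform_family n r \<A> \<longrightarrow> card \<A> = (n - 1) choose (r - 1) \<longrightarrow>
       real (intersecting_distance \<A>) \<le> real ((n - 1) choose (r - 1)) powr (1 - \<eta>) \<longrightarrow>
       real (disjoint_pairs \<A>) \<ge>
         real (intersecting_distance \<A>) powr (1 + \<delta>) - C * real (intersecting_distance \<A>)))))"
proof (intro allI impI)
  fix \<epsilon> :: real assume eps: "0 < \<epsilon>"
  \<comment> \<open>Chosen so that the square of \<open>b powr n\<close> is the lower bound of
    \<open>choose_exponential\<close>: one factor \<open>b powr n\<close> absorbs the polynomial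
    \<open>8 * n ^ 7\<close>, the other absorbs \<open>l powr \<delta>\<close>.\<close>
  define b where "b = (1 + 2 * \<epsilon>) powr (\<epsilon> / 2)"
  have b: "1 < b" using eps by (simp add: b_def)
  obtain N where N: "8 * real n ^ 7 \<le> b powr real n" if "N \<le> n" for n
    using eventually_poly_le_exp[OF b] by blast
  \<comment> \<open>From \<open>m\<close> on, the polynomial is absorbed and
    \<open>\<epsilon> * n \<ge> 1\<close>, which gives \<open>1 \<le> r\<close> and
    \<open>2 * r + 2 \<le> n\<close>. Smaller \<open>n\<close> are covered by the constant
    \<open>b powr m\<close>.\<close>
  define m where "m = max N (nat \<lceil>1 / \<epsilon>\<rceil>)"
  \<comment> \<open>With this exponent \<open>l \<le> 2 ^ n\<close> yields
    \<open>l powr \<delta> \<le> b powr n\<close>.\<close>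
  define \<delta> where "\<delta> = log 2 b"
  have delta: "0 < \<delta>" using b by (simp add: \<delta>_def)
  have main: "real (intersecting_distance \<A>) powr (1 + \<delta>) - b powr real m * real (intersecting_distance \<A>)
      \<le> real (disjoint_pairs \<A>)"
    if n: "1 \<le> n" and r: "\<epsilon> * real n \<le> real r" "real r \<le> (1 / 2 - \<epsilon>) * real n"
      and A: "uniform_family n r \<A>" "card \<A> = (n - 1) choose (r - 1)"
    for n r and \<A> :: "nat set set"
  proof -
    define l e where "l = real (intersecting_distance \<A>)" and "e = real (disjoint_pairs \<A>)"
    have l0: "0 \<le> l" and e0: "0 \<le> e" by (simp_all add: l_def e_def)
    have "l \<le> 2 powr real n"
      using intersecting_distance_le_power[OF A(1)] by (simp add: l_def powr_realpow flip: of_nat_le_iff)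
    then have "l powr \<delta> \<le> (2 powr real n) powr \<delta>" using l0 delta by (intro powr_mono2) auto
    also have "\<dots> = (2 powr \<delta>) powr real n" by (simp add: powr_powr mult.commute)
    also have "2 powr \<delta> = b" using b by (simp add: \<delta>_def)
    finally have "l * l powr \<delta> \<le> l * b powr real n" using l0 by (rule mult_left_mono)
    then have lb: "l powr (1 + \<delta>) \<le> l * b powr real n" using l0 by (simp add: powr_add)
    have "l powr (1 + \<delta>) \<le> b powr real m * l + e"
    proof (cases "n < m")
      case True
      have "l * b powr real n \<le> l * b powr real m"
        using True b l0 by (intro mult_left_mono powr_mono) auto
      with lb e0 show ?thesis by (simp add: mult.commute)
    next
      case False
      have "1 / \<epsilon> \<le> real n" using False by (simp add: m_def nat_le_iff ceiling_le_iff not_less)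
      then have en: "1 \<le> \<epsilon> * real n" using eps by (simp add: field_simps)
      have "real (2 * r + 2) \<le> real n" using r(2) en by (simp add: algebra_simps)
      then have rn: "2 * r + 2 \<le> n" by (simp only: of_nat_le_iff)
      have r1: "1 \<le> r" using r(1) en by simp
      interpret cyclic_arcs n r \<A>
        using rn r1 A(1) by unfold_locales (simp_all add: uniform_family_def)
      have "real (intersecting_distance \<A> * ((n - r) choose r)) \<le> real (8 * n ^ 7 * disjoint_pairs \<A>)"
        using disjoint_pairs_lower_bound[OF A(2)] by (simp only: of_nat_le_iff)
      then have key: "l * real ((n - r) choose r) \<le> 8 * real n ^ 7 * e" by (simp add: l_def e_def)
      have "b powr real n * b powr real n = (1 + 2 * \<epsilon>) powr (\<epsilon> * real n)"
        by (simp add: b_def powr_powr flip: powr_add)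
      then have "b powr real n * b powr real n \<le> real ((n - r) choose r)"
        using choose_exponential[OF eps r r1] by simp
      then have "l * (b powr real n * b powr real n) \<le> 8 * real n ^ 7 * e"
        using key mult_left_mono[OF _ l0] order_trans by blast
      also have "\<dots> \<le> b powr real n * e" using N[of n] False e0 by (intro mult_right_mono) (auto simp: m_def)
      finally have "b powr real n * (l * b powr real n) \<le> b powr real n * e" by (simp add: mult_ac)
      then have "l * b powr real n \<le> e" using b by simp
      with lb l0 show ?thesis by (smt (verit) powr_ge_zero mult_nonneg_nonneg)
    qed
    then show ?thesis by (simp add: l_def e_def)
  qed
  show "\<exists>C::real. C > 0 \<and> (\<forall>\<eta>::real. \<eta> > 0 \<longrightarrow> (\<exists>\<delta>::real. \<delta> > 0 \<and>
    (\<forall>(n::nat) (r::nat) (\<A> :: nat set set).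
       1 \<le> n \<longrightarrow> \<epsilon> * real n \<le> real r \<longrightarrow> real r \<le> (1 / 2 - \<epsilon>) * real n \<longrightarrow>
       uniform_family n r \<A> \<longrightarrow> card \<A> = (n - 1) choose (r - 1) \<longrightarrow>
       real (intersecting_distance \<A>) \<le> real ((n - 1) choose (r - 1)) powr (1 - \<eta>) \<longrightarrow>
       real (disjoint_pairs \<A>) \<ge>
         real (intersecting_distance \<A>) powr (1 + \<delta>) - C * real (intersecting_distance \<A>))))"
    using main delta b by (intro exI[of _ "b powr real m"] exI[of _ \<delta>] conjI allI impI) auto
qed

end
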